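(* Let $G$ be a finite simple connected graph with $m>0$ edges and minimum degree $\delta\ge 1$. Then $$DSO(G) \le \frac{SO(G)}{2\delta}.$$ Equality holds if and only if $G$ is regular.
   Context: For a finite simple graph $G=(V(G),E(G))$, $d_u$ denotes the degree of the vertex $u$. The Diminished Sombor index is $DSO(G)=\sum_{uv\in E(G)}\frac{\sqrt{d_u^2+d_v^2}}{d_u+d_v}$. The Sombor index is $SO(G)=\sum_{uv\in E(G)}\sqrt{d_u^2+d_v^2}$. *)

theory Defs
  imports Complex_Main "Graph_Theory.Graph_Theory"
begin

text \<open>
  Finite simple graphs are the loop-free symmetric digraphs without parallel arcs of
  \<^locale>\<open>graph\<close>. An undirected edge is represented there by a pair of opposite arcs,
  so \<open>edges G\<close> identifies the two and contains every undirected edge exactly once.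
\<close>

definition edges :: "('a, 'b) pre_digraph \<Rightarrow> 'a set set" where
  "edges G = (\<lambda>e. {tail G e, head G e}) ` arcs G"

text \<open>
  By symmetry, and as there are no parallel arcs, the arcs leaving a vertex correspond
  to its incident edges.
\<close>

definition deg :: "('a, 'b) pre_digraph \<Rightarrow> 'a \<Rightarrow> nat" where
  "deg G v = out_degree G v"

definition min_degree :: "('a, 'b) pre_digraph \<Rightarrow> nat" where
  "min_degree G = Min (deg G ` verts G)"

definition regular :: "('a, 'b) pre_digraph \<Rightarrow> bool" where
  "regular G \<longleftrightarrow> (\<exists>r. \<forall>v \<in> verts G. deg G v = r)"

text \<open>
  An edge of a loop-free graph has exactly two endpoints. The inner sums range over these
  endpoints: for an edge with endpoints \<open>u \<noteq> v\<close> they are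
  \<open>d\<^sub>u\<^sup>2 + d\<^sub>v\<^sup>2\<close> and \<open>d\<^sub>u + d\<^sub>v\<close>.
\<close>

definition SO :: "('a, 'b) pre_digraph \<Rightarrow> real" where
  "SO G = (\<Sum>e \<in> edges G. sqrt (\<Sum>w \<in> e. (real (deg G w))\<^sup>2))"

definition DSO :: "('a, 'b) pre_digraph \<Rightarrow> real" where
  "DSO G = (\<Sum>e \<in> edges G.
     sqrt (\<Sum>w \<in> e. (real (deg G w))\<^sup>2) / (\<Sum>w \<in> e. real (deg G w)))"

end

theory Submission
  imports Defs
begin

text \<open>
  The inequality holds edge by edge. Both endpoints of an edge have degree at least
  \<open>\<delta>\<close>, so the denominator \<open>d\<^sub>u + d\<^sub>v\<close> of its contribution to \<open>DSO\<close> is at least \<open>2 \<delta>\<close>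
  (lemma \<open>edge_degree_sum\<close>), and the edge contributes no more to \<open>DSO\<close> than to
  \<open>SO / (2 \<delta>)\<close>.

  Equality of the two sums forces equality for every single edge. As the numerators are
  positive, this means \<open>d\<^sub>u + d\<^sub>v = 2 \<delta>\<close>, hence \<open>d\<^sub>u = d\<^sub>v = \<delta>\<close>. Since \<open>\<delta> \<ge> 1\<close>, every vertex
  lies on an edge, so the local information covers the whole graph and all degrees are
  \<open>\<delta>\<close>. Conversely, in a regular graph all the denominators are \<open>2 \<delta>\<close>.
\<close>

lemma (in fin_digraph) min_degree_le:
  assumes "v \<in> verts G"
  shows "min_degree G \<le> deg G v"
  using assms by (simp add: min_degree_def)

lemma (in fin_digraph) regular_imp_deg_eq_min_degree:
  assumes "regular G" "v \<in> verts G"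
  shows "deg G v = min_degree G"
proof -
  from assms obtain r where r: "\<And>w. w \<in> verts G \<Longrightarrow> deg G w = r"
    unfolding regular_def by blast
  then have "deg G ` verts G = {r}"
    using assms(2) by auto
  then show ?thesis
    using r assms(2) by (simp add: min_degree_def)
qed

lemma (in loopfree_digraph) edgeE:
  assumes "e \<in> edges G"
  obtains u v where "u \<in> verts G" "v \<in> verts G" "u \<noteq> v" "e = {u, v}"
proof -
  obtain a where a: "a \<in> arcs G" "e = {tail G a, head G a}"
    using assms unfolding edges_def by blast
  then show thesis
    using that[of "tail G a" "head G a"] no_loops[OF a(1)] by simp
qed

lemma (in fin_digraph) finite_edges: "finite (edges G)"
  by (simp add: edges_def)

lemma in_some_edge:
  assumes "deg G v > 0"
  shows "\<exists>e \<in> edges G. v \<in> e"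
proof -
  have "out_arcs G v \<noteq> {}"
    using assms by (auto simp: deg_def out_degree_def)
  then show ?thesis
    by (auto simp: edges_def)
qed

text \<open>
  Two numbers that are each at least \<open>\<delta>\<close> have sum at least \<open>2 \<delta>\<close>, with equality only if both
  equal \<open>\<delta>\<close>. Absence of loops matters: a loop would be a singleton \<open>e\<close>, whose degree sum has
  only one summand.
\<close>

lemma
  assumes "graph G" "e \<in> edges G"
  shows edge_degree_sum: "2 * real (min_degree G) \<le> (\<Sum>w \<in> e. real (deg G w))"
    and edge_degree_sum_eq_iff:
      "(\<Sum>w \<in> e. real (deg G w)) = 2 * real (min_degree G) \<longleftrightarrow>
        (\<forall>w \<in> e. deg G w = min_degree G)"
proof -
  interpret graph G by fact
  obtain u v where uv: "u \<in> verts G" "v \<in> verts G" "u \<noteq> v" "e = {u, v}"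
    using assms(2) by (rule edgeE)
  have "min_degree G \<le> deg G u" "min_degree G \<le> deg G v"
    using uv min_degree_le by auto
  then show "2 * real (min_degree G) \<le> (\<Sum>w \<in> e. real (deg G w))"
    and "(\<Sum>w \<in> e. real (deg G w)) = 2 * real (min_degree G) \<longleftrightarrow>
        (\<forall>w \<in> e. deg G w = min_degree G)"
    using uv by auto
qed

lemma edge_sqrt_pos:
  assumes "graph G" "e \<in> edges G" "min_degree G > 0"
  shows "0 < sqrt (\<Sum>w \<in> e. (real (deg G w))\<^sup>2)"
proof -
  interpret graph G by fact
  obtain u v where uv: "u \<in> verts G" "v \<in> verts G" "u \<noteq> v" "e = {u, v}"
    using assms(2) by (rule edgeE)
  have "0 < deg G u"
    using assms(3) min_degree_le[OF uv(1)] by simp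
  then show ?thesis
    using uv by (simp add: add_pos_nonneg)
qed

theorem proposition1:
  fixes G :: "('a, 'b) pre_digraph"
  assumes "graph G"
    and "Digraph_Component.connected G"
    and "card (edges G) > 0"
    and "min_degree G \<ge> 1"
  shows "DSO G \<le> SO G / (2 * real (min_degree G)) \<and>
    (DSO G = SO G / (2 * real (min_degree G)) \<longleftrightarrow> regular G)"
proof -
  interpret graph G by fact
  define d where "d = real (min_degree G)"
  define t where "t e = sqrt (\<Sum>w \<in> e. (real (deg G w))\<^sup>2)" for e
  define s where "s e = (\<Sum>w \<in> e. real (deg G w))" for e
  have d_pos: "0 < d"
    using assms(4) by (simp add: d_def)
  have t_pos: "0 < t e" if "e \<in> edges G" for e
    using edge_sqrt_pos[OF assms(1) that] assms(4) by (simp add: t_def)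
  have s_ge: "2 * d \<le> s e" if "e \<in> edges G" for e
    using edge_degree_sum[OF assms(1) that] by (simp add: s_def d_def)
  have s_eq: "s e = 2 * d \<longleftrightarrow> (\<forall>w \<in> e. deg G w = min_degree G)" if "e \<in> edges G" for e
    using edge_degree_sum_eq_iff[OF assms(1) that] by (simp add: s_def d_def)
  have DSO: "DSO G = (\<Sum>e \<in> edges G. t e / s e)"
    by (simp add: DSO_def t_def s_def)
  have SO: "SO G / (2 * d) = (\<Sum>e \<in> edges G. t e / (2 * d))"
    by (simp add: SO_def t_def sum_divide_distrib)
  have term_le: "t e / s e \<le> t e / (2 * d)" if "e \<in> edges G" for e
    using t_pos[OF that] s_ge[OF that] d_pos by (intro divide_left_mono) auto
  have "DSO G \<le> SO G / (2 * d)"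
    unfolding DSO SO by (rule sum_mono) (rule term_le)
  moreover have "DSO G = SO G / (2 * d) \<longleftrightarrow> regular G"
  proof
    assume eq: "DSO G = SO G / (2 * d)"
    have "deg G v = min_degree G" if v: "v \<in> verts G" for v
    proof -
      have "0 < deg G v"
        using min_degree_le[OF v] assms(4) by simp
      then obtain e where e: "e \<in> edges G" "v \<in> e"
        using in_some_edge[of G v] by auto
      have "t e / s e = t e / (2 * d)"
        using sum_mono_inv[OF eq[unfolded DSO SO] term_le e(1) finite_edges] .
      then have "s e = 2 * d"
        using t_pos[OF e(1)] s_ge[OF e(1)] d_pos by (simp add: frac_eq_eq)
      then show ?thesis
        using s_eq[OF e(1)] e(2) by blast
    qed
    then show "regular G"
      unfolding regular_def by blast
  next
    assume reg: "regular G"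
    have "s e = 2 * d" if e: "e \<in> edges G" for e
    proof -
      have "deg G w = min_degree G" if "w \<in> e" for w
        using that e by (elim edgeE) (auto intro: regular_imp_deg_eq_min_degree[OF reg])
      then show ?thesis
        using s_eq[OF e] by blast
    qed
    then show "DSO G = SO G / (2 * d)"
      unfolding DSO SO by (intro sum.cong) auto
  qed
  ultimately show ?thesis
    unfolding d_def by blast
qed

end
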